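(* Let $Z=(z_{ij})_{1\le i,j\le n}$ be an IPR and let $u\in\mathcal{N}$. Then $Z$ is consistent with respect to $u$ if and only if there exists an IPR $X$ that is consistent with respect to $[0,0]$, with entries $[x_{ij},x_{ij}]$ identified with real numbers $x_{ij}$, such that $$z_{ij}=\left[x_{ij}-\frac{\ell(u)}{2},\,x_{ij}+\frac{\ell(u)}{2}\right]\quad\text{for all } i,j=1,\dots,n.$$ Further, in this case, intervals $v_1,\dots,v_n\in\mathcal{I}(\mathbb{R})$ are interval-valued priority values for $Z$ if and only if the real numbers $\nu_1=\frac{v_1^-+v_1^+}{2},\dots,\nu_n=\frac{v_n^-+v_n^+}{2}$ are priority values for $X$.
   Context: $\mathcal{I}(\mathbb{R})$ is the set of closed bounded intervals $z=[z^-,z^+]\subseteq\mathbb{R}$ with $z^-\le z^+$ (degenerate intervals $[a,a]$ allowed), and $\ell(z)=z^+-z^-$ is the length of $z$. Arithmetic: $z_1+z_2=\{x_1+x_2: x_1\in z_1, x_2\in z_2\}$, $-z=[-z^+,-z^-]$, and $z_1-z_2=\{x_1-x_2: x_1\in z_1,x_2\in z_2\}=[z_1^--z_2^+,\,z_1^+-z_2^-]$. The set of neutral intervals is $\mathcal{N}=\{[-\varepsilon,\varepsilon]:\varepsilon\ge 0\}$. An interval preference relation (IPR) of order $n$ is an $n\times n$ matrix $Z=(z_{ij})$ with entries $z_{ij}\in\mathcal{I}(\mathbb{R})$ satisfying the reciprocity condition $z_{ij}=-z_{ji}$ for all $i,j=1,\dots,n$. An IPR $Z$ is consistent with respect to $u\in\mathcal{N}$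 if $z_{ij}+u=z_{ik}+z_{kj}$ for all $i,j,k=1,\dots,n$. An IPR consistent with respect to $[0,0]$ has only degenerate entries, so it is identified with a real matrix $X=(x_{ij})$ satisfying $x_{ij}=x_{ik}+x_{kj}$ for all $i,j,k$. Intervals $v_1,\dots,v_n\in\mathcal{I}(\mathbb{R})$ are (interval-valued) priority values for an IPR $Z$ consistent with respect to $u$ if $z_{ij}+u=v_i-v_j$ for all $i,j=1,\dots,n$. In particular, real numbers $\nu_1,\dots,\nu_n$ are priority values for $X$ (consistent with respect to $[0,0]$) if $x_{ij}=\nu_i-\nu_j$ for all $i,j$.
   Formalization: The "if" half of the second claim fails as printed (Z=0, u=[0,0], X=0, v_i=[-1,1]); it is corrected to: v_1,…,v_n are priority values for Z iff ℓ(v_i)=ℓ(u) for all i and the midpoints ν_i are priority values for X. *)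

theory Defs
  imports "HOL-Analysis.Analysis" "HOL-Library.Interval"
begin

definition neutral_intervals :: "real interval set" where
  "neutral_intervals = {u. \<exists>\<epsilon>\<ge>0. set_of u = {-\<epsilon>..\<epsilon>}}"

definition IPR :: "real interval ^ 'n ^ 'n \<Rightarrow> bool" where
  "IPR Z \<longleftrightarrow> (\<forall>i j. Z $ i $ j = - (Z $ j $ i))"

definition consistent :: "real interval \<Rightarrow> real interval ^ 'n ^ 'n \<Rightarrow> bool" where
  "consistent u Z \<longleftrightarrow> (\<forall>i j k. Z $ i $ j + u = Z $ i $ k + Z $ k $ j)"

text \<open>Interval arithmetic gives \<open>width (v i - v i) = 2 * width (v i)\<close>. Hence, when \<open>Z\<close> is an
  IPR consistent with respect to \<open>u\<close> (so that \<open>Z $ i $ i = u\<close>), the case \<open>i = j\<close> below forces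
  \<open>width (v i) = width u\<close> for every \<open>i\<close>: the midpoints of the \<open>v i\<close> alone do not determine
  whether the \<open>v i\<close> are priority values.\<close>

definition priority_values ::
    "real interval \<Rightarrow> real interval ^ 'n ^ 'n \<Rightarrow> ('n \<Rightarrow> real interval) \<Rightarrow> bool" where
  "priority_values u Z v \<longleftrightarrow> (\<forall>i j. Z $ i $ j + u = v i - v j)"

text \<open>The identification of a real matrix with an interval matrix having degenerate entries.\<close>

definition degenerate :: "real ^ 'n ^ 'n \<Rightarrow> real interval ^ 'n ^ 'n" where
  "degenerate x = (\<chi> i j. interval_of (x $ i $ j))"

end

theory Submission
  imports Defs
begin

text \<open>Setting \<open>i = j = k\<close> in consistency gives \<open>z\<^sub>i\<^sub>i = u\<close>; setting \<open>i = j\<close> then gives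
  \<open>2 u = z\<^sub>i\<^sub>k - z\<^sub>i\<^sub>k\<close>, so every entry has the width of \<open>u\<close>. As \<open>u\<close> is centred at 0, what remains of
  consistency is additivity of the midpoints, and the matrix of midpoints is the required \<open>x\<close>.\<close>

lemma set_of_eq_atLeastAtMost_iff:
  fixes z :: "'a::linorder interval"
  assumes "a \<le> b"
  shows "set_of z = {a..b} \<longleftrightarrow> lower z = a \<and> upper z = b"
  using assms lower_le_upper[of z] by (auto simp: set_of_eq Icc_eq_Icc)

lemma width_nonneg: "0 \<le> width (z :: 'a::linordered_idom interval)"
  using lower_le_upper[of z] by (simp add: width_def)

text \<open>Since widths are nonnegative, the right-hand set is a nonempty interval and so
  determines its endpoints. This turns the set equations of the theorem into linear
  equations.\<close>

lemma set_of_eq_centered_iff: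
  fixes z u :: "real interval"
  shows "set_of z = {m - width u / 2 .. m + width u / 2} \<longleftrightarrow>
    lower z = m - width u / 2 \<and> upper z = m + width u / 2"
  using width_nonneg[of u] by (intro set_of_eq_atLeastAtMost_iff) simp

text \<open>If \<open>u\<close> is [-\<epsilon>, \<epsilon>], its width is 2\<epsilon>, so
  \<epsilon> can be expressed through \<open>width u\<close>.\<close>

lemma neutral_intervals_endpoints:
  assumes "u \<in> neutral_intervals"
  shows "lower u = - width u / 2" "upper u = width u / 2"
proof -
  obtain e where "0 \<le> e" "set_of u = {-e..e}"
    using assms by (auto simp: neutral_intervals_def)
  then have "lower u = -e" "upper u = e"
    using set_of_eq_atLeastAtMost_iff[of "-e" e u] by auto
  then show "lower u = - width u / 2" "upper u = width u / 2"
    by (simp_all add: width_def)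
qed

lemma IPR_iff:
  "IPR Z \<longleftrightarrow> (\<forall>i j. lower (Z $ i $ j) = - upper (Z $ j $ i) \<and> upper (Z $ i $ j) = - lower (Z $ j $ i))"
  by (simp add: IPR_def interval_eq_iff)

lemma consistent_iff:
  "consistent u Z \<longleftrightarrow> (\<forall>i j k.
    lower (Z $ i $ j) + lower u = lower (Z $ i $ k) + lower (Z $ k $ j) \<and>
    upper (Z $ i $ j) + upper u = upper (Z $ i $ k) + upper (Z $ k $ j))"
  by (simp add: consistent_def interval_eq_iff)

lemma priority_values_iff:
  "priority_values u Z v \<longleftrightarrow> (\<forall>i j.
    lower (Z $ i $ j) + lower u = lower (v i) - upper (v j) \<and>
    upper (Z $ i $ j) + upper u = upper (v i) - lower (v j))"
  by (simp add: priority_values_def interval_eq_iff)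

lemma IPR_degenerate_iff: "IPR (degenerate x) \<longleftrightarrow> (\<forall>i j. x $ i $ j = - x $ j $ i)"
  by (simp add: IPR_iff degenerate_def)

lemma consistent_degenerate_iff:
  "consistent 0 (degenerate x) \<longleftrightarrow> (\<forall>i j k. x $ i $ j = x $ i $ k + x $ k $ j)"
  by (simp add: consistent_iff degenerate_def)

lemma priority_values_degenerate_iff:
  "priority_values 0 (degenerate x) (\<lambda>i. interval_of (m i)) \<longleftrightarrow> (\<forall>i j. x $ i $ j = m i - m j)"
  by (simp add: priority_values_iff degenerate_def)

lemma consistent_width:
  assumes "IPR Z" "consistent u Z"
  shows "width (Z $ i $ j) = width u"
proof -
  note c = assms(2)[unfolded consistent_iff, rule_format]
  note r = assms(1)[unfolded IPR_iff, rule_format]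
  show ?thesis
    using c[of i i i] c[of i i j] r[of i j] by (simp add: width_def)
qed

lemma consistent_iff_centered:
  fixes Z :: "real interval ^ 'n ^ 'n"
  assumes "IPR Z" "u \<in> neutral_intervals"
  shows "consistent u Z \<longleftrightarrow>
    (\<exists>x. IPR (degenerate x) \<and> consistent 0 (degenerate x) \<and>
      (\<forall>i j. set_of (Z $ i $ j) = {x $ i $ j - width u / 2 .. x $ i $ j + width u / 2}))"
    (is "_ \<longleftrightarrow> ?R")
proof
  assume Z: "consistent u Z"
  note c = Z[unfolded consistent_iff, rule_format]
  note r = assms(1)[unfolded IPR_iff, rule_format]
  note e = neutral_intervals_endpoints[OF assms(2)]
  define x :: "real ^ 'n ^ 'n" where "x = (\<chi> i j. (lower (Z $ i $ j) + upper (Z $ i $ j)) / 2)"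
  have "x $ i $ j = - x $ j $ i" for i j
    using r[of i j] by (simp add: x_def field_simps)
  \<comment> \<open>Add the equations for lower and upper endpoints: the endpoints of
    \<open>u\<close> cancel because \<open>u\<close> is neutral.\<close>
  moreover have "x $ i $ j = x $ i $ k + x $ k $ j" for i j k
    using c[of i j k] e by (simp add: x_def field_simps)
  moreover have "lower (Z $ i $ j) = x $ i $ j - width u / 2 \<and>
      upper (Z $ i $ j) = x $ i $ j + width u / 2" for i j
    \<comment> \<open>Once \<open>width u\<close> is replaced by the width of the entry itself, the
      claim only says that an interval is its midpoint plus or minus half its width.\<close>
    unfolding consistent_width[OF assms(1) Z, of i j, symmetric]
    by (simp add: x_def width_def field_simps)
  ultimately show ?R
    unfolding IPR_degenerate_iff consistent_degenerate_iff set_of_eq_centered_iff by blast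
next
  assume ?R
  \<comment> \<open>Both sides of each endpoint equation are shifted by the same amount,
    \<open>- width u\<close> below and \<open>width u\<close> above, so additivity of
    \<open>x\<close> suffices.\<close>
  then show "consistent u Z"
    using neutral_intervals_endpoints[OF assms(2)]
    unfolding consistent_degenerate_iff set_of_eq_centered_iff
    by (auto simp: consistent_iff)
qed

text \<open>An interval is determined by its midpoint and width. Comparing midpoints in
  \<open>Z $ i $ j + u = v i - v j\<close> gives the real equation for \<open>x\<close>; comparing
  widths gives \<open>2 * width u = width (v i) + width (v j)\<close>, which for all
  \<open>i\<close> and \<open>j\<close> means that every \<open>v i\<close> has the width of
  \<open>u\<close>.\<close>

lemma priority_values_iff_midpoints:
  fixes Z :: "real interval ^ 'n ^ 'n" and x :: "real ^ 'n ^ 'n"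
  assumes "u \<in> neutral_intervals" "consistent 0 (degenerate x)"
    and "\<And>i j. set_of (Z $ i $ j) = {x $ i $ j - width u / 2 .. x $ i $ j + width u / 2}"
  shows "priority_values u Z v \<longleftrightarrow>
    (\<forall>i. width (v i) = width u) \<and>
    priority_values 0 (degenerate x) (\<lambda>i. interval_of ((lower (v i) + upper (v i)) / 2))"
    (is "_ \<longleftrightarrow> ?W \<and> ?P")
proof
  note e = neutral_intervals_endpoints[OF assms(1)]
  note z = assms(3)[unfolded set_of_eq_centered_iff]
  {
    assume "priority_values u Z v"
    note p = this[unfolded priority_values_iff, rule_format]
    \<comment> \<open>A zero diagonal makes \<open>Z $ i $ i\<close> equal to \<open>u\<close>, so
      the diagonal priority equation reads \<open>u + u = v i - v i\<close> and fixes the width of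
      \<open>v i\<close>.\<close>
    have "x $ i $ i = 0" for i
      using assms(2)[unfolded consistent_degenerate_iff, rule_format, of i i i] by simp
    then have "width (v i) = width u" for i
      using p[of i i] z[of i i] e by (simp add: width_def[of "v i"])
    moreover have "x $ i $ j = (lower (v i) + upper (v i)) / 2 - (lower (v j) + upper (v j)) / 2" for i j
      using p[of i j] z[of i j] e by (simp add: field_simps)
    ultimately show "?W \<and> ?P"
      unfolding priority_values_degenerate_iff by blast
  next
    assume "?W \<and> ?P"
    then have w: "upper (v i) - lower (v i) = width u"
      and p: "x $ i $ j = (lower (v i) + upper (v i)) / 2 - (lower (v j) + upper (v j)) / 2" for i j
      unfolding priority_values_degenerate_iff by (simp_all add: width_def[of "v _"])
    \<comment> \<open>Each \<open>v i\<close> is its midpoint plus or minus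
      \<open>width u / 2\<close>, so both sides are \<open>x $ i $ j - width u\<close> for the lower
      endpoints and \<open>x $ i $ j + width u\<close> for the upper ones.\<close>
    have "lower (Z $ i $ j) + lower u = lower (v i) - upper (v j) \<and>
        upper (Z $ i $ j) + upper u = upper (v i) - lower (v j)" for i j
      using w[of i] w[of j] p[of i j] z[of i j] e by argo
    then show "priority_values u Z v"
      unfolding priority_values_iff by blast
  }
qed

theorem theorem2:
  fixes Z :: "real interval ^ 'n ^ 'n" and u :: "real interval"
  assumes "IPR Z" and "u \<in> neutral_intervals"
  shows "(consistent u Z \<longleftrightarrow>
      (\<exists>x :: real ^ 'n ^ 'n. IPR (degenerate x) \<and> consistent 0 (degenerate x) \<and>
        (\<forall>i j. set_of (Z $ i $ j) = {x $ i $ j - width u / 2 .. x $ i $ j + width u / 2}))) \<and>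
    (\<forall>x :: real ^ 'n ^ 'n. IPR (degenerate x) \<and> consistent 0 (degenerate x) \<and>
        (\<forall>i j. set_of (Z $ i $ j) = {x $ i $ j - width u / 2 .. x $ i $ j + width u / 2}) \<longrightarrow>
      (\<forall>v :: 'n \<Rightarrow> real interval.
        priority_values u Z v \<longleftrightarrow>
          (\<forall>i. width (v i) = width u) \<and>
          priority_values 0 (degenerate x) (\<lambda>i. interval_of ((lower (v i) + upper (v i)) / 2))))"
  using consistent_iff_centered[OF assms] priority_values_iff_midpoints[OF assms(2)] by blast

end
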